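(* For every $n\ge1$ let $\theta_{0,n}\in\Theta_n$ and let $X^n\sim P_{\theta_{0,n},n}$ (planted bi-section model with edge probabilities $p_n,q_n\in(0,1)$). Equip every $\Theta_n$ with its uniform prior. Let $(k_n)$ be a sequence of positive integers with $k_n=O(n)$ and suppose $$\frac{n}{k_n}\Bigl(1-p_n-q_n+2p_nq_n+2\sqrt{p_n(1-p_n)q_n(1-q_n)}\Bigr)^{n/2}\to0\qquad(n\to\infty).$$ Let $W_n=\{\theta\in\Theta_n: k(\theta,\theta_{0,n})\ge k_n\}=\bigcup_{k=k_n}^{\lfloor n/2\rfloor}\{\theta\in\Theta_n:k(\theta,\theta_{0,n})=k\}$. Then $$\Pi(W_n|X^n)\to0\quad\text{in }P_{\theta_{0,n},n}\text{-probability, as }n\to\infty,$$ i.e. the posterior recovers $\theta_{0,n}$ with error rate $k_n$.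
   Context: Planted bi-section model. For $n\ge1$, $\Theta_n'$ is the set of $\theta'\in\{0,1\}^{2n}$ with exactly $n$ zeros and $n$ ones. Let $\neg\theta'$ denote component-wise negation, let $\sim_n$ be the equivalence relation identifying $\theta'$ with $\neg\theta'$, and let $\Theta_n=\Theta_n'/\sim_n$. Given $p_n,q_n\in(0,1)$ and $\theta\in\Theta_n$ with representative $\theta'$, $P_{\theta,n}$ is the law of the random simple undirected graph $X^n$ (no loops) on vertices $\{1,\dots,2n\}$, with adjacency indicators $X_{ij}$ ($i<j$), whose edges occur independently with $P_{\theta,n}(X_{ij}=1)=p_n$ if $\theta'_i=\theta'_j$ and $=q_n$ if $\theta'_i\ne\theta'_j$ (independent of the representative). Let $p_{\theta,n}(x^n)=P_{\theta,n}(X^n=x^n)$ be the likelihood. With the uniform prior on $\Theta_n$, the posterior is, for $A\subset\Theta_n$, $$\Pi(A|X^n)=\sum_{\theta\in A}p_{\theta,n}(X^n)\Big/\sum_{\theta\in\Theta_n}p_{\theta,n}(X^n).$$ Metric on $\Theta_n$: for $\theta_1',\theta_2'\in\Theta_n'$ put $Z(\theta')=\{i:\theta'_i=0\}$ and $k'(\theta_1',\theta_2')=|Z(\theta_1')\setminus Z(\theta_2')|$ (minimal number of pair exchanges turning $\theta_1'$ into $\theta_2'$). For $\theta_1,\theta_2\in\Theta_n$ with representatives $\theta_1',\theta_2'$, $k(\theta_1,\theta_2)=\min\{k'(\theta_1',\theta_2'),k'(\theta_1',\neg\theta_2')\}\in\{0,\dots,\lfloor n/2\rfloor\}$. *)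

theory Defs
  imports
    "HOL-Probability.Probability"
    "HOL-Probability.Product_PMF"
    "HOL-Library.Landau_Symbols"
begin

(* Theta' n: elements of {0,1}^(2n), as functions on {1..2n} that are undefined elsewhere. *)

definition zeros :: "nat \<Rightarrow> (nat \<Rightarrow> nat) \<Rightarrow> nat set" where
  "zeros n t = {i \<in> {1..2*n}. t i = 0}"

definition ones :: "nat \<Rightarrow> (nat \<Rightarrow> nat) \<Rightarrow> nat set" where
  "ones n t = {i \<in> {1..2*n}. t i = 1}"

definition Theta' :: "nat \<Rightarrow> (nat \<Rightarrow> nat) set" where
  "Theta' n = {t \<in> {1..2*n} \<rightarrow>\<^sub>E {0, 1}. card (zeros n t) = n \<and> card (ones n t) = n}"

definition neg :: "nat \<Rightarrow> (nat \<Rightarrow> nat) \<Rightarrow> (nat \<Rightarrow> nat)" where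
  "neg n t = (\<lambda>i\<in>{1..2*n}. 1 - t i)"

definition sim :: "nat \<Rightarrow> ((nat \<Rightarrow> nat) \<times> (nat \<Rightarrow> nat)) set" where
  "sim n = {(s, t). s \<in> Theta' n \<and> t \<in> Theta' n \<and> (t = s \<or> t = neg n s)}"

definition Theta :: "nat \<Rightarrow> (nat \<Rightarrow> nat) set set" where
  "Theta n = Theta' n // sim n"

(* Any choice of representative will do: see graph_law_eq and kdist_eq below. *)
definition repr :: "(nat \<Rightarrow> nat) set \<Rightarrow> (nat \<Rightarrow> nat)" where
  "repr \<theta> = (SOME t. t \<in> \<theta>)"

definition vertex_pairs :: "nat \<Rightarrow> (nat \<times> nat) set" where
  "vertex_pairs n = {(i, j). 1 \<le> i \<and> i < j \<and> j \<le> 2*n}"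

(* A simple graph on {1..2n} is given by its adjacency indicators X (i, j), i < j;
   X is False outside vertex_pairs n. *)
definition graph_law' :: "nat \<Rightarrow> real \<Rightarrow> real \<Rightarrow> (nat \<Rightarrow> nat) \<Rightarrow> (nat \<times> nat \<Rightarrow> bool) pmf" where
  "graph_law' n p q t =
     Pi_pmf (vertex_pairs n) False (\<lambda>(i, j). bernoulli_pmf (if t i = t j then p else q))"

definition graph_law :: "nat \<Rightarrow> real \<Rightarrow> real \<Rightarrow> (nat \<Rightarrow> nat) set \<Rightarrow> (nat \<times> nat \<Rightarrow> bool) pmf" where
  "graph_law n p q \<theta> = graph_law' n p q (repr \<theta>)"

definition likelihood ::
  "nat \<Rightarrow> real \<Rightarrow> real \<Rightarrow> (nat \<Rightarrow> nat) set \<Rightarrow> (nat \<times> nat \<Rightarrow> bool) \<Rightarrow> real" where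
  "likelihood n p q \<theta> x = pmf (graph_law n p q \<theta>) x"

definition posterior ::
  "nat \<Rightarrow> real \<Rightarrow> real \<Rightarrow> (nat \<Rightarrow> nat) set set \<Rightarrow> (nat \<times> nat \<Rightarrow> bool) \<Rightarrow> real" where
  "posterior n p q A x =
     (\<Sum>\<theta>\<in>A. likelihood n p q \<theta> x) / (\<Sum>\<theta>\<in>Theta n. likelihood n p q \<theta> x)"

definition kdist' :: "nat \<Rightarrow> (nat \<Rightarrow> nat) \<Rightarrow> (nat \<Rightarrow> nat) \<Rightarrow> nat" where
  "kdist' n s t = card (zeros n s - zeros n t)"

definition kdist :: "nat \<Rightarrow> (nat \<Rightarrow> nat) set \<Rightarrow> (nat \<Rightarrow> nat) set \<Rightarrow> nat" where
  "kdist n \<theta> \<eta> = min (kdist' n (repr \<theta>) (repr \<eta>)) (kdist' n (repr \<theta>) (neg n (repr \<eta>)))"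


lemma Theta'_values: "t \<in> Theta' n \<Longrightarrow> i \<in> {1..2*n} \<Longrightarrow> t i = 0 \<or> t i = 1"
  unfolding Theta'_def by (auto simp: PiE_iff)

lemma ones_eq_compl_zeros: "t \<in> Theta' n \<Longrightarrow> ones n t = {1..2*n} - zeros n t"
  using Theta'_values unfolding ones_def zeros_def by fastforce

lemma zeros_neg: "t \<in> Theta' n \<Longrightarrow> zeros n (neg n t) = ones n t"
  using Theta'_values unfolding ones_def zeros_def neg_def by fastforce

lemma ones_neg: "t \<in> Theta' n \<Longrightarrow> ones n (neg n t) = zeros n t"
  using Theta'_values unfolding ones_def zeros_def neg_def by fastforce

lemma neg_in_Theta': assumes "t \<in> Theta' n" shows "neg n t \<in> Theta' n"
proof -
  have "neg n t \<in> {1..2*n} \<rightarrow>\<^sub>E {0, 1}"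
    using Theta'_values[OF assms] unfolding neg_def by fastforce
  then show ?thesis
    using assms zeros_neg[OF assms] ones_neg[OF assms] unfolding Theta'_def by auto
qed

lemma neg_neg: assumes "t \<in> Theta' n" shows "neg n (neg n t) = t"
proof
  fix i
  show "neg n (neg n t) i = t i"
  proof (cases "i \<in> {1..2*n}")
    case True
    then show ?thesis using Theta'_values[OF assms True] unfolding neg_def by auto
  next
    case False
    then show ?thesis using assms unfolding Theta'_def neg_def by (auto simp: PiE_iff extensional_def)
  qed
qed

lemma equiv_sim: "equiv (Theta' n) (sim n)"
  unfolding equiv_def refl_on_def sym_def trans_def sim_def using neg_neg by auto

lemma Theta_cases:
  assumes "\<theta> \<in> Theta n"
  obtains t where "t \<in> Theta' n" "\<theta> = {t, neg n t}"
  using assms neg_in_Theta' unfolding Theta_def quotient_def sim_def by fastforce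

lemma repr_cases:
  assumes "\<theta> \<in> Theta n" "t \<in> \<theta>"
  shows "t \<in> Theta' n" "repr \<theta> = t \<or> repr \<theta> = neg n t"
proof -
  have r: "repr \<theta> \<in> \<theta>" using assms(2) unfolding repr_def by (metis someI)
  obtain s where s: "s \<in> Theta' n" "\<theta> = {s, neg n s}" using Theta_cases[OF assms(1)] .
  show "t \<in> Theta' n" using s assms(2) neg_in_Theta' by auto
  show "repr \<theta> = t \<or> repr \<theta> = neg n t" using s r assms(2) neg_neg by auto
qed

lemma repr_in_Theta': "\<theta> \<in> Theta n \<Longrightarrow> repr \<theta> \<in> Theta' n"
  by (metis Theta_cases insertI1 neg_in_Theta' repr_cases(2))

lemma finite_vertex_pairs: "finite (vertex_pairs n)"
  by (rule finite_subset[of _ "{1..2*n} \<times> {1..2*n}"]) (auto simp: vertex_pairs_def)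

lemma finite_Theta: "finite (Theta n)"
proof -
  have "finite (Theta' n)"
    by (rule finite_subset[of _ "{1..2*n} \<rightarrow>\<^sub>E {0, 1}"]) (auto simp: Theta'_def intro!: finite_PiE)
  then show ?thesis
    unfolding Theta_def by (rule finite_quotient) (auto simp: sim_def)
qed

lemma graph_law'_neg:
  assumes "t \<in> Theta' n"
  shows "graph_law' n p q (neg n t) = graph_law' n p q t"
proof -
  have "neg n t i = neg n t j \<longleftrightarrow> t i = t j" if "(i, j) \<in> vertex_pairs n" for i j
  proof -
    have i: "i \<in> {1..2*n}" and j: "j \<in> {1..2*n}" using that by (auto simp: vertex_pairs_def)
    show ?thesis
      using i j Theta'_values[OF assms i] Theta'_values[OF assms j] unfolding neg_def by auto
  qed
  then show ?thesis
    unfolding graph_law'_def by (intro Pi_pmf_cong) auto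
qed

lemma graph_law_eq:
  assumes "\<theta> \<in> Theta n" "t \<in> \<theta>"
  shows "graph_law n p q \<theta> = graph_law' n p q t"
  using repr_cases[OF assms] graph_law'_neg unfolding graph_law_def by metis

lemma kdist'_plus_neg:
  assumes "s \<in> Theta' n" "t \<in> Theta' n"
  shows "kdist' n s t + kdist' n s (neg n t) = n"
proof -
  have fin: "finite (zeros n s)" by (simp add: zeros_def)
  have "zeros n s = (zeros n s - zeros n t) \<union> (zeros n s - ({1..2*n} - zeros n t))"
    by (auto simp: zeros_def)
  moreover have "(zeros n s - zeros n t) \<inter> (zeros n s - ({1..2*n} - zeros n t)) = {}"
    by (auto simp: zeros_def)
  ultimately have "card (zeros n s) = kdist' n s t + kdist' n s (neg n t)"
    unfolding kdist'_def zeros_neg[OF assms(2)] ones_eq_compl_zeros[OF assms(2)]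
    using fin by (metis card_Un_disjoint finite_Diff)
  then show ?thesis using assms(1) by (simp add: Theta'_def)
qed

lemma kdist'_commute:
  assumes "s \<in> Theta' n" "t \<in> Theta' n"
  shows "kdist' n s t = kdist' n t s"
proof -
  have "finite (zeros n s)" "finite (zeros n t)" by (simp_all add: zeros_def)
  moreover have "card (zeros n s) = card (zeros n t)" using assms by (simp add: Theta'_def)
  ultimately show ?thesis
    unfolding kdist'_def by (simp add: card_Diff_subset_Int Int_commute)
qed

lemma kdist'_neg_left:
  assumes "s \<in> Theta' n" "t \<in> Theta' n"
  shows "kdist' n (neg n s) t = kdist' n s (neg n t)"
proof -
  have "kdist' n (neg n s) t = kdist' n t (neg n s)"
    using kdist'_commute assms neg_in_Theta' by blast
  then show ?thesis
    using kdist'_plus_neg[OF assms] kdist'_plus_neg[OF assms(2,1)] kdist'_commute[OF assms] by linarith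
qed

lemma kdist_eq:
  assumes "\<theta> \<in> Theta n" "\<eta> \<in> Theta n" "s \<in> \<theta>" "t \<in> \<eta>"
  shows "kdist n \<theta> \<eta> = min (kdist' n s t) (kdist' n s (neg n t))"
proof -
  note s = repr_cases[OF assms(1,3)] and t = repr_cases[OF assms(2,4)]
  show ?thesis
    using s(2) t(2) unfolding kdist_def
    by (elim disjE) (simp_all add: s(1) t(1) neg_neg neg_in_Theta' kdist'_neg_left min.commute)
qed

lemma kdist_le:
  assumes "\<theta> \<in> Theta n" "\<eta> \<in> Theta n"
  shows "kdist n \<theta> \<eta> \<le> n div 2"
  using kdist'_plus_neg[OF assms[THEN repr_in_Theta']] unfolding kdist_def by linarith

lemma far_set_eq_UN:
  assumes "\<theta>0 \<in> Theta n"
  shows "{\<theta> \<in> Theta n. kdist n \<theta> \<theta>0 \<ge> m} = (\<Union>k\<in>{m..n div 2}. {\<theta> \<in> Theta n. kdist n \<theta> \<theta>0 = k})"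
  using kdist_le[OF _ assms] by auto

(* The posterior is the one obtained by Bayes' rule from the uniform prior on Theta n. *)
lemma posterior_uniform_prior:
  assumes "A \<subseteq> Theta n" "Theta n \<noteq> {}"
  shows "posterior n p q A x =
    (\<Sum>\<theta>\<in>A. pmf (pmf_of_set (Theta n)) \<theta> * likelihood n p q \<theta> x) /
    (\<Sum>\<theta>\<in>Theta n. pmf (pmf_of_set (Theta n)) \<theta> * likelihood n p q \<theta> x)"
proof -
  have eq: "(\<Sum>\<theta>\<in>B. pmf (pmf_of_set (Theta n)) \<theta> * likelihood n p q \<theta> x) =
      (1 / card (Theta n)) * (\<Sum>\<theta>\<in>B. likelihood n p q \<theta> x)" if "B \<subseteq> Theta n" for B
    unfolding sum_distrib_left
    by (rule sum.cong) (use that assms(2) finite_Theta in \<open>auto simp: pmf_of_set\<close>)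
  have "card (Theta n) \<noteq> 0" using assms(2) finite_Theta by auto
  then show ?thesis
    unfolding posterior_def eq[OF assms(1)] eq[OF subset_refl] by simp
qed

end

theory Submission
  imports Defs
begin

text \<open>
  The argument is a union bound over the distance \<open>m\<close> to the truth \<open>\<eta>\<close>, in the style of Hellinger
  testing. On the support of the true law, the posterior weight of a single alternative \<open>\<theta>\<close> is at
  most \<open>sqrt (L \<theta> / L \<eta>)\<close>, where \<open>L\<close> is the likelihood
  (\<open>posterior_le_sum_sqrt_ratio\<close>). Under \<open>\<eta>\<close> this root has expectation
  \<open>\<Sum>x. sqrt (L \<theta> x * L \<eta> x)\<close>, the Hellinger affinity of the two laws. Since edges are independent,
  the affinity is a product over vertex pairs: a pair contributes \<open>1\<close> if both labellings
  put its ends in the same group or both separate them, and otherwise contributes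
  \<open>a = sqrt (p * q) + sqrt ((1 - p) * (1 - q))\<close>, whose square is the base that appears in the rate
  condition.

  If \<open>\<theta>\<close> is at distance \<open>m\<close> from \<open>\<eta>\<close>, the two labellings disagree on a set of \<open>2 * m\<close> vertices (for
  suitable representatives), and the pairs joined by one labelling and split by the other are those
  with exactly one end in this set. There are \<open>2 * m * (2 * n - 2 * m)\<close> of them, which is at least \<open>2 * m * n\<close>
  because \<open>m \<le> n / 2\<close> (\<open>card_separated_pairs_repr\<close>). At most \<open>(n choose m)\<^sup>2\<close> classes lie
  at distance \<open>m\<close> (\<open>card_Theta_kdist\<close>). Hence the expected posterior mass of the classes at distance
  at least \<open>k\<close> is bounded by the sum over \<open>m \<ge> k\<close> of
  \<open>(n choose m)\<^sup>2 * a ^ (2 * m * n) \<le> (exp 1 * n / k * a ^ n) ^ (2 * m)\<close>. The rate condition says that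
  \<open>n / k * a ^ n\<close> tends to \<open>0\<close>, so this is a geometric sum with vanishing ratio and first exponent
  \<open>m \<ge> 1\<close> (\<open>sum_far_le_geometric\<close>). Markov's inequality turns the bound on the expectation into
  convergence in probability (\<open>prob_posterior_far_le\<close>).
\<close>

section \<open>Affinity of product Bernoulli laws\<close>

definition bernoulli_affinity :: "real \<Rightarrow> real \<Rightarrow> real" where
  "bernoulli_affinity p q = sqrt (p * q) + sqrt ((1 - p) * (1 - q))"

lemma bernoulli_affinity_self:
  assumes "p \<in> {0<..<1}"
  shows "bernoulli_affinity p p = 1"
  using assms by (simp add: bernoulli_affinity_def)

lemma bernoulli_affinity_commute: "bernoulli_affinity p q = bernoulli_affinity q p"
  by (simp add: bernoulli_affinity_def mult.commute)

lemma bernoulli_affinity_pos: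
  assumes "p \<in> {0<..<1}" "q \<in> {0<..<1}"
  shows "bernoulli_affinity p q > 0"
  using assms by (simp add: bernoulli_affinity_def add_pos_pos)

lemma bernoulli_affinity_le_1:
  assumes "p \<in> {0<..<1}" "q \<in> {0<..<1}"
  shows "bernoulli_affinity p q \<le> 1"
proof -
  have "sqrt (p * q) \<le> (p + q) / 2" "sqrt ((1 - p) * (1 - q)) \<le> ((1 - p) + (1 - q)) / 2"
    using assms by (intro arith_geo_mean_sqrt; simp)+
  then show ?thesis unfolding bernoulli_affinity_def by argo
qed

text \<open>
  The expression in the rate condition is a squared affinity, so its power \<open>n / 2\<close> is the \<open>n\<close>-th
  power of the affinity.
\<close>

lemma bernoulli_affinity_power2:
  assumes "p \<in> {0<..<1}" "q \<in> {0<..<1}"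
  shows "(bernoulli_affinity p q)\<^sup>2 =
    1 - p - q + 2 * p * q + 2 * sqrt (p * (1 - p) * q * (1 - q))"
proof -
  have "sqrt (p * q) * sqrt ((1 - p) * (1 - q)) = sqrt (p * (1 - p) * q * (1 - q))"
    by (simp add: real_sqrt_mult[symmetric] mult_ac)
  moreover have "(sqrt (p * q))\<^sup>2 = p * q" "(sqrt ((1 - p) * (1 - q)))\<^sup>2 = (1 - p) * (1 - q)"
    using assms by simp_all
  ultimately show ?thesis
    unfolding bernoulli_affinity_def power2_sum by (simp add: algebra_simps)
qed

lemma expectation_sqrt_ratio_bernoulli:
  assumes "p \<in> {0<..<1}" "q \<in> {0<..<1}"
  shows "measure_pmf.expectation (bernoulli_pmf p)
      (\<lambda>y. sqrt (pmf (bernoulli_pmf q) y / pmf (bernoulli_pmf p) y)) = bernoulli_affinity p q"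
proof -
  have eq: "sqrt (b / a) * a = sqrt (a * b)" if "a > 0" for a b :: real
  proof -
    have "sqrt (a * b) = sqrt (b / a * a\<^sup>2)"
      using that by (simp add: power2_eq_square mult.commute)
    also have "\<dots> = sqrt (b / a) * a"
      using that by (simp add: real_sqrt_mult del: times_divide_eq_left)
    finally show ?thesis by simp
  qed
  show ?thesis
    using assms eq[of p q] eq[of "1 - p" "1 - q"]
    by (simp add: bernoulli_affinity_def mult_ac)
qed

lemma sqrt_prod: "sqrt (\<Prod>x\<in>A. f x) = (\<Prod>x\<in>A. sqrt (f x))"
  by (induction A rule: infinite_finite_induct) (simp_all add: real_sqrt_mult)

text \<open>
  Tensorization of the affinity: the likelihood ratio of two product laws is a product of functions of
  the single coordinates, and these are independent.
\<close>

lemma expectation_sqrt_ratio_Pi_bernoulli: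
  fixes A :: "'a set"
  assumes "finite A" and r: "\<And>x. x \<in> A \<Longrightarrow> r x \<in> {0<..<1}" "\<And>x. x \<in> A \<Longrightarrow> r' x \<in> {0<..<1}"
  shows "measure_pmf.expectation (Pi_pmf A False (\<lambda>x. bernoulli_pmf (r x)))
      (\<lambda>f. sqrt (pmf (Pi_pmf A False (\<lambda>x. bernoulli_pmf (r' x))) f /
                 pmf (Pi_pmf A False (\<lambda>x. bernoulli_pmf (r x))) f)) =
    (\<Prod>x\<in>A. bernoulli_affinity (r x) (r' x))"
proof -
  let ?P = "Pi_pmf A False (\<lambda>x. bernoulli_pmf (r x))"
  let ?Q = "Pi_pmf A False (\<lambda>x. bernoulli_pmf (r' x))"
  define g where "g x y = sqrt (pmf (bernoulli_pmf (r' x)) y / pmf (bernoulli_pmf (r x)) y)" for x y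
  have "measure_pmf.expectation ?P (\<lambda>f. sqrt (pmf ?Q f / pmf ?P f)) =
        measure_pmf.expectation ?P (\<lambda>f. \<Prod>x\<in>A. g x (f x))"
  proof (rule integral_cong_AE)
    show "AE f in ?P. sqrt (pmf ?Q f / pmf ?P f) = (\<Prod>x\<in>A. g x (f x))"
    proof (rule AE_pmfI)
      fix f assume "f \<in> set_pmf ?P"
      then have out: "f x = False" if "x \<notin> A" for x
        using set_Pi_pmf_subset[OF assms(1), of False "\<lambda>x. bernoulli_pmf (r x)"] that by blast
      have eq: "pmf (Pi_pmf A False P) f = (\<Prod>x\<in>A. pmf (P x) (f x))" for P
        by (rule pmf_Pi'[OF assms(1) out])
      show "sqrt (pmf ?Q f / pmf ?P f) = (\<Prod>x\<in>A. g x (f x))"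
        unfolding g_def eq prod_dividef[symmetric]
        by (rule sqrt_prod)
    qed
  qed simp_all
  also have "\<dots> = (\<Prod>x\<in>A. measure_pmf.expectation (bernoulli_pmf (r x)) (g x))"
    by (rule expectation_prod_Pi_pmf)
       (auto simp: assms(1) g_def intro: integrable_measure_pmf_finite)
  also have "\<dots> = (\<Prod>x\<in>A. bernoulli_affinity (r x) (r' x))"
    unfolding g_def using r by (intro prod.cong refl expectation_sqrt_ratio_bernoulli) auto
  finally show ?thesis .
qed

section \<open>Combinatorics of bi-sections\<close>

text \<open>
  Let \<open>D\<close> be the set of the \<open>2 * d\<close> vertices on which the two labellings differ, where \<open>d\<close> is their
  exchange distance. As there are only two labels, flipping the label of exactly one end of a pair
  changes whether the ends agree, while flipping both or none does not; so the separated pairs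
  correspond to \<open>D \<times> - D\<close>. A lower bound on their number is what
  bounds the affinity from above, because every factor is at most \<open>1\<close>.
\<close>

lemma card_separated_pairs:
  assumes s: "s \<in> Theta' n" and t: "t \<in> Theta' n"
  shows "4 * kdist' n s t * (n - kdist' n s t) \<le>
    card {(i, j) \<in> vertex_pairs n. (s i = s j) \<noteq> (t i = t j)}"
proof -
  define d where "d = kdist' n s t"
  define D where "D = {i \<in> {1..2*n}. s i \<noteq> t i}"
  have fin: "finite (zeros n u)" for u by (simp add: zeros_def)
  have "D = (zeros n s - zeros n t) \<union> (zeros n t - zeros n s)"
    using Theta'_values[OF s] Theta'_values[OF t] unfolding D_def zeros_def by fastforce
  then have "card D = card (zeros n s - zeros n t) + card (zeros n t - zeros n s)"
    using fin by (auto intro: card_Un_disjoint)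
  then have cD: "card D = 2 * d"
    using kdist'_commute[OF s t] by (simp add: kdist'_def d_def)
  have "D \<subseteq> {1..2*n}" by (auto simp: D_def)
  then have cD': "card ({1..2*n} - D) = 2 * n - 2 * d"
    by (subst card_Diff_subset) (auto simp: cD finite_subset)
  \<comment> \<open>Vertex pairs are stored in increasing order, so elements of \<open>D \<times> - D\<close> must be sorted.\<close>
  let ?f = "\<lambda>(i, j). (min i j, max i j :: nat)"
  have "4 * d * (n - d) = card (D \<times> ({1..2*n} - D))"
    unfolding card_cartesian_product cD cD' by (simp add: algebra_simps diff_mult_distrib2)
  also have "\<dots> = card (?f ` (D \<times> ({1..2*n} - D)))"
  proof (rule card_image[symmetric], rule inj_onI, clarify, intro conjI)
    fix i j i' j'
    assume *: "i \<in> D" "j \<notin> D" "i' \<in> D" "j' \<notin> D" "min i j = min i' j'" "max i j = max i' j'"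
    then have "i = i' \<and> j = j' \<or> i = j' \<and> j = i'" by (auto simp: min_def max_def split: if_splits)
    with * show "i = i'" "j = j'" by auto
  qed
  also have "\<dots> \<le> card {(i, j) \<in> vertex_pairs n. (s i = s j) \<noteq> (t i = t j)}"
  proof (rule card_mono)
    show "finite {(i, j) \<in> vertex_pairs n. (s i = s j) \<noteq> (t i = t j)}"
      by (rule finite_subset[OF _ finite_vertex_pairs]) auto
    have "?f (i, j) \<in> {(i, j) \<in> vertex_pairs n. (s i = s j) \<noteq> (t i = t j)}"
      if "i \<in> D" "j \<in> {1..2*n} - D" for i j
    proof -
      have ij: "i \<noteq> j" "i \<in> {1..2*n}" "j \<in> {1..2*n}" "s i \<noteq> t i" "s j = t j"
        using that by (auto simp: D_def)
      have "(s i = s j) \<noteq> (t i = t j)" "(s j = s i) \<noteq> (t j = t i)"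
        using Theta'_values[OF s ij(2)] Theta'_values[OF s ij(3)]
          Theta'_values[OF t ij(2)] ij(4,5) by metis+
      then show ?thesis
        using ij(1-3) by (cases "i < j") (simp_all add: vertex_pairs_def)
    qed
    then show "?f ` (D \<times> ({1..2*n} - D)) \<subseteq> {(i, j) \<in> vertex_pairs n. (s i = s j) \<noteq> (t i = t j)}"
      by (intro image_subsetI) (simp only: mem_Times_iff split_paired_all fst_conv snd_conv)
  qed
  finally show ?thesis by (simp add: d_def)
qed

text \<open>
  The count \<open>4 * d * (n - d)\<close> is invariant under \<open>d \<mapsto> n - d\<close>, that is, under negating one
  representative, so \<open>d\<close> may be replaced by the smaller distance \<open>m\<close>, for which \<open>n - m \<ge> n / 2\<close>.
\<close>

lemma card_separated_pairs_repr:
  assumes "\<theta> \<in> Theta n" "\<eta> \<in> Theta n"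
  shows "2 * kdist n \<theta> \<eta> * n \<le>
    card {(i, j) \<in> vertex_pairs n. (repr \<theta> i = repr \<theta> j) \<noteq> (repr \<eta> i = repr \<eta> j)}"
proof -
  define d where "d = kdist' n (repr \<theta>) (repr \<eta>)"
  define m where "m = kdist n \<theta> \<eta>"
  note r = repr_in_Theta'[OF assms(1)] repr_in_Theta'[OF assms(2)]
  have dn: "d + kdist' n (repr \<theta>) (neg n (repr \<eta>)) = n"
    using kdist'_plus_neg[OF r] by (simp add: d_def)
  then have m: "m = d \<and> n - d \<ge> d \<or> m = n - d \<and> d \<ge> n - d" "d \<le> n"
    by (auto simp: m_def kdist_def d_def[symmetric] min_def)
  obtain e where e: "n = d + e" using m(2) le_Suc_ex by blast
  have "2 * m * n \<le> 4 * d * (n - d)"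
    using m unfolding e by (auto simp: algebra_simps)
  with card_separated_pairs[OF r] show ?thesis
    unfolding m_def d_def by linarith
qed

text \<open>
  A balanced labelling at exchange distance \<open>m\<close> from \<open>t\<close> is determined by which \<open>m\<close> zeros of \<open>t\<close> become
  ones and which \<open>m\<close> ones of \<open>t\<close> become zeros.
\<close>

lemma card_Theta'_kdist':
  assumes t: "t \<in> Theta' n"
  shows "finite {s \<in> Theta' n. kdist' n s t = m}"
    and "card {s \<in> Theta' n. kdist' n s t = m} \<le> (n choose m)\<^sup>2"
proof -
  define S where "S = {s \<in> Theta' n. kdist' n s t = m}"
  define Z where "Z = zeros n t"
  define C where "C = {A. A \<subseteq> Z \<and> card A = m} \<times> {B. B \<subseteq> {1..2*n} - Z \<and> card B = m}"
  have Z: "finite Z" "Z \<subseteq> {1..2*n}" "card Z = n"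
    using t by (auto simp: Z_def zeros_def Theta'_def)
  have inj: "inj_on (\<lambda>s. (Z - zeros n s, zeros n s - Z)) S"
  proof (rule inj_onI)
    fix s s' assume s: "s \<in> S" "s' \<in> S"
      and eq: "(Z - zeros n s, zeros n s - Z) = (Z - zeros n s', zeros n s' - Z)"
    then have z: "zeros n s = zeros n s'" by blast
    have T: "s \<in> Theta' n" "s' \<in> Theta' n" using s by (auto simp: S_def)
    show "s = s'"
    proof
      fix i
      show "s i = s' i"
      proof (cases "i \<in> {1..2*n}")
        case True
        have "s i = 0 \<longleftrightarrow> s' i = 0" using z True by (auto simp: zeros_def)
        then show ?thesis using Theta'_values[OF T(1) True] Theta'_values[OF T(2) True] by auto
      next
        case False
        then show ?thesis using T by (auto simp: Theta'_def PiE_iff extensional_def)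
      qed
    qed
  qed
  have "Z - zeros n s \<subseteq> Z \<and> card (Z - zeros n s) = m"
       "zeros n s - Z \<subseteq> {1..2*n} - Z \<and> card (zeros n s - Z) = m" if "s \<in> S" for s
    using that kdist'_commute[of s n t] t
    by (auto simp: S_def Z_def kdist'_def zeros_def)
  then have sub: "(\<lambda>s. (Z - zeros n s, zeros n s - Z)) ` S \<subseteq> C"
    unfolding C_def by blast
  have finC: "finite C"
    using Z(1) by (auto simp: C_def)
  have "card ({1..2*n} - Z) = n"
    using Z by (simp add: card_Diff_subset)
  then have "card C = (n choose m)\<^sup>2"
    unfolding C_def card_cartesian_product using Z by (simp add: n_subsets power2_eq_square)
  moreover have "card S \<le> card C" by (rule card_inj_on_le[OF inj sub finC])
  ultimately show "card {s \<in> Theta' n. kdist' n s t = m} \<le> (n choose m)\<^sup>2"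
    by (simp add: S_def)
  show "finite {s \<in> Theta' n. kdist' n s t = m}"
    using inj_on_finite[OF inj sub finC] by (simp add: S_def)
qed

text \<open>
  Each class at distance \<open>m\<close> contains a labelling that attains the minimum, so no more classes than
  labellings have to be counted.
\<close>

lemma card_Theta_kdist:
  assumes \<eta>: "\<eta> \<in> Theta n"
  shows "card {\<theta> \<in> Theta n. kdist n \<theta> \<eta> = m} \<le> (n choose m)\<^sup>2"
proof -
  define t where "t = repr \<eta>"
  have t: "t \<in> Theta' n" using repr_in_Theta'[OF \<eta>] by (simp add: t_def)
  have t\<eta>: "t \<in> \<eta>"
    unfolding t_def repr_def by (metis Theta_cases[OF \<eta>] insertI1 someI)
  let ?S = "{s \<in> Theta' n. kdist' n s t = m}"
  have "{\<theta> \<in> Theta n. kdist n \<theta> \<eta> = m} \<subseteq> (\<lambda>s. {s, neg n s}) ` ?S"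
  proof clarify
    fix \<theta> assume \<theta>: "\<theta> \<in> Theta n" and m: "m = kdist n \<theta> \<eta>"
    obtain s where s: "s \<in> Theta' n" "\<theta> = {s, neg n s}" using Theta_cases[OF \<theta>] .
    have "kdist n \<theta> \<eta> = min (kdist' n s t) (kdist' n (neg n s) t)"
      using kdist_eq[OF \<theta> \<eta> _ t\<eta>, of s] s kdist'_neg_left[OF s(1) t] by simp
    then consider "kdist' n s t = m" | "kdist' n (neg n s) t = m" using m by linarith
    then show "\<theta> \<in> (\<lambda>s. {s, neg n s}) ` {s \<in> Theta' n. kdist' n s t = kdist n \<theta> \<eta>}"
    proof cases
      case 1
      then show ?thesis using s m by blast
    next
      case 2
      have "\<theta> = {neg n s, neg n (neg n s)}" using s neg_neg[OF s(1)] by auto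
      then show ?thesis using 2 m neg_in_Theta'[OF s(1)] by blast
    qed
  qed
  then have "card {\<theta> \<in> Theta n. kdist n \<theta> \<eta> = m} \<le> card ?S"
    using card_Theta'_kdist'(1)[OF t] by (rule surj_card_le[rotated])
  also note card_Theta'_kdist'(2)[OF t]
  finally show ?thesis .
qed

section \<open>Expected posterior mass far from the truth\<close>

lemma expectation_sqrt_likelihood_ratio:
  assumes pq: "p \<in> {0<..<1}" "q \<in> {0<..<1}" and \<theta>: "\<theta> \<in> Theta n" "\<eta> \<in> Theta n"
  shows "measure_pmf.expectation (graph_law n p q \<eta>)
      (\<lambda>x. sqrt (likelihood n p q \<theta> x / likelihood n p q \<eta> x)) \<le>
    bernoulli_affinity p q ^ (2 * kdist n \<theta> \<eta> * n)"
proof -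
  let ?a = "bernoulli_affinity p q"
  define r where "r = (\<lambda>t :: nat \<Rightarrow> nat. \<lambda>(i, j). if t i = t j then p else q)"
  define N where "N = {(i, j) \<in> vertex_pairs n. (repr \<theta> i = repr \<theta> j) \<noteq> (repr \<eta> i = repr \<eta> j)}"
  have law: "graph_law n p q \<theta> =
      Pi_pmf (vertex_pairs n) False (\<lambda>x. bernoulli_pmf (r (repr \<theta>) x))" for \<theta>
    unfolding graph_law_def graph_law'_def r_def by (simp add: case_prod_beta')
  have "measure_pmf.expectation (graph_law n p q \<eta>)
      (\<lambda>x. sqrt (likelihood n p q \<theta> x / likelihood n p q \<eta> x)) =
      (\<Prod>x\<in>vertex_pairs n. bernoulli_affinity (r (repr \<eta>) x) (r (repr \<theta>) x))"
    unfolding likelihood_def law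
    by (rule expectation_sqrt_ratio_Pi_bernoulli[OF finite_vertex_pairs])
       (use pq in \<open>auto simp: r_def\<close>)
  also have "\<dots> = (\<Prod>x\<in>vertex_pairs n. if x \<in> N then ?a else 1)"
    using pq by (intro prod.cong refl)
      (auto simp: r_def N_def bernoulli_affinity_self bernoulli_affinity_commute[of q p]
        split: if_splits)
  also have "\<dots> = (\<Prod>x\<in>vertex_pairs n \<inter> N. ?a)"
    by (rule prod.inter_restrict[symmetric, OF finite_vertex_pairs])
  also have "\<dots> = ?a ^ card N"
  proof -
    have "vertex_pairs n \<inter> N = N" by (auto simp: N_def)
    then show ?thesis by simp
  qed
  also have "\<dots> \<le> ?a ^ (2 * kdist n \<theta> \<eta> * n)"
    using card_separated_pairs_repr[OF \<theta>] bernoulli_affinity_le_1[OF pq] bernoulli_affinity_pos[OF pq]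
    by (intro power_decreasing) (auto simp: N_def)
  finally show ?thesis .
qed

lemma likelihood_nonneg: "likelihood n p q \<theta> x \<ge> 0"
  by (simp add: likelihood_def)

lemma posterior_nonneg: "posterior n p q A x \<ge> 0"
  by (simp add: posterior_def sum_nonneg likelihood_nonneg)

text \<open>
  The posterior weight of \<open>\<theta>\<close> is at most \<open>1\<close> and at most the likelihood ratio against \<open>\<eta>\<close>, because the
  normalizing sum contains both terms; hence it is at most their geometric mean. The square root
  matters: the likelihood ratio itself has expectation \<open>1\<close> under \<open>\<eta>\<close> and would give no decay.
\<close>

lemma posterior_le_sum_sqrt_ratio:
  assumes \<eta>: "\<eta> \<in> Theta n" and A: "A \<subseteq> Theta n" and pos: "likelihood n p q \<eta> x > 0"
  shows "posterior n p q A x \<le> (\<Sum>\<theta>\<in>A. sqrt (likelihood n p q \<theta> x / likelihood n p q \<eta> x))"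
proof -
  let ?L = "\<lambda>\<theta>. likelihood n p q \<theta> x"
  define S where "S = (\<Sum>\<theta>\<in>Theta n. ?L \<theta>)"
  have le: "?L \<theta> \<le> S" if "\<theta> \<in> Theta n" for \<theta>
    unfolding S_def using that by (intro member_le_sum likelihood_nonneg finite_Theta)
  have "?L \<theta> / S \<le> sqrt (?L \<theta> / ?L \<eta>)" if "\<theta> \<in> A" for \<theta>
  proof -
    have S: "?L \<theta> \<le> S" "?L \<eta> \<le> S" "S > 0"
      using le that A \<eta> pos by (auto intro: less_le_trans)
    show ?thesis
    proof (rule real_le_rsqrt)
      have "?L \<theta> / S \<le> ?L \<theta> / ?L \<eta>" "?L \<theta> / S \<le> 1" "?L \<theta> / S \<ge> 0"
        using S pos likelihood_nonneg by (auto intro!: divide_left_mono)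
      then have "(?L \<theta> / S) * (?L \<theta> / S) \<le> (?L \<theta> / ?L \<eta>) * 1"
        by (intro mult_mono) auto
      then show "(?L \<theta> / S)\<^sup>2 \<le> ?L \<theta> / ?L \<eta>" by (simp add: power2_eq_square)
    qed
  qed
  then show ?thesis
    unfolding posterior_def S_def[symmetric] sum_divide_distrib by (rule sum_mono)
qed

lemma finite_set_graph_law: "finite (set_pmf (graph_law n p q \<theta>))"
  unfolding graph_law_def graph_law'_def
  by (rule finite_subset[OF set_Pi_pmf_subset'[OF finite_vertex_pairs]])
     (auto intro: finite_PiE_dflt finite_vertex_pairs)

lemma prob_posterior_far_le:
  assumes pq: "p \<in> {0<..<1}" "q \<in> {0<..<1}" and \<eta>: "\<eta> \<in> Theta n" and "\<epsilon> > 0"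
  shows "measure_pmf.prob (graph_law n p q \<eta>)
      {x. \<bar>posterior n p q {\<theta> \<in> Theta n. kdist n \<theta> \<eta> \<ge> k} x\<bar> > \<epsilon>} \<le>
    (\<Sum>m=k..n div 2. real (n choose m) ^ 2 * bernoulli_affinity p q ^ (2 * m * n)) / \<epsilon>"
proof -
  let ?P = "graph_law n p q \<eta>" and ?a = "bernoulli_affinity p q"
  define W where "W = {\<theta> \<in> Theta n. kdist n \<theta> \<eta> \<ge> k}"
  define R where "R \<theta> x = sqrt (likelihood n p q \<theta> x / likelihood n p q \<eta> x)" for \<theta> x
  define U where "U x = (\<Sum>\<theta>\<in>W. R \<theta> x)" for x
  have int: "integrable ?P f" for f :: "_ \<Rightarrow> real"
    by (rule integrable_measure_pmf_finite[OF finite_set_graph_law])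
  have U0: "U x \<ge> 0" for x
    by (simp add: U_def R_def sum_nonneg likelihood_nonneg)
  have finW: "finite W" using finite_Theta by (simp add: W_def)
  have "measure_pmf.prob ?P {x. \<bar>posterior n p q W x\<bar> > \<epsilon>} \<le> measure_pmf.prob ?P {x. U x \<ge> \<epsilon>}"
  proof (rule measure_pmf.finite_measure_mono_AE)
    show "AE x in ?P. x \<in> {x. \<bar>posterior n p q W x\<bar> > \<epsilon>} \<longrightarrow> x \<in> {x. U x \<ge> \<epsilon>}"
    proof (rule AE_pmfI)
      fix x assume "x \<in> set_pmf ?P"
      then have "likelihood n p q \<eta> x > 0" by (simp add: likelihood_def pmf_positive)
      then have "posterior n p q W x \<le> U x"
        unfolding U_def R_def using \<eta> by (intro posterior_le_sum_sqrt_ratio) (auto simp: W_def)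
      then show "x \<in> {x. \<bar>posterior n p q W x\<bar> > \<epsilon>} \<longrightarrow> x \<in> {x. U x \<ge> \<epsilon>}"
        by (simp add: posterior_nonneg)
    qed
  qed simp
  also have "\<dots> \<le> measure_pmf.expectation ?P U / \<epsilon>"
    using integral_Markov_inequality_measure[OF int[of U], of "{}" \<epsilon>] U0 \<open>\<epsilon> > 0\<close> by simp
  also have "measure_pmf.expectation ?P U = (\<Sum>\<theta>\<in>W. measure_pmf.expectation ?P (R \<theta>))"
    unfolding U_def by (rule Bochner_Integration.integral_sum) (rule int)
  also have "\<dots> \<le> (\<Sum>\<theta>\<in>W. ?a ^ (2 * kdist n \<theta> \<eta> * n))"
    unfolding R_def using pq \<eta> by (intro sum_mono expectation_sqrt_likelihood_ratio) (auto simp: W_def)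
  also have "\<dots> = (\<Sum>m=k..n div 2. \<Sum>\<theta>\<in>{\<theta> \<in> W. kdist n \<theta> \<eta> = m}. ?a ^ (2 * kdist n \<theta> \<eta> * n))"
    using kdist_le[OF _ \<eta>] by (intro sum.group[symmetric] finW) (auto simp: W_def)
  also have "\<dots> \<le> (\<Sum>m=k..n div 2. real (n choose m) ^ 2 * ?a ^ (2 * m * n))"
  proof (rule sum_mono)
    fix m assume m: "m \<in> {k..n div 2}"
    have "{\<theta> \<in> W. kdist n \<theta> \<eta> = m} = {\<theta> \<in> Theta n. kdist n \<theta> \<eta> = m}"
      using m by (auto simp: W_def)
    then have "real (card {\<theta> \<in> W. kdist n \<theta> \<eta> = m}) \<le> real ((n choose m)\<^sup>2)"
      using card_Theta_kdist[OF \<eta>, of m] by (simp only: of_nat_le_iff)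
    then have "real (card {\<theta> \<in> W. kdist n \<theta> \<eta> = m}) * ?a ^ (2 * m * n) \<le>
        real (n choose m) ^ 2 * ?a ^ (2 * m * n)"
      using bernoulli_affinity_pos[OF pq] by (intro mult_right_mono) auto
    then show "(\<Sum>\<theta>\<in>{\<theta> \<in> W. kdist n \<theta> \<eta> = m}. ?a ^ (2 * kdist n \<theta> \<eta> * n)) \<le>
        real (n choose m) ^ 2 * ?a ^ (2 * m * n)"
      by simp
  qed
  finally show ?thesis using \<open>\<epsilon> > 0\<close> by (simp add: W_def divide_right_mono)
qed

section \<open>Summation over the distance\<close>

text \<open>
  The left-hand side divided by \<open>fact m\<close> is a single term of the exponential series at \<open>m\<close>.
\<close>

lemma power_self_le_fact_exp: "real m ^ m \<le> fact m * exp (real m)"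
proof -
  have "(\<Sum>i\<in>{m}. real m ^ i /\<^sub>R fact i) \<le> (\<Sum>i. real m ^ i /\<^sub>R fact i)"
    by (rule sum_le_suminf[OF summable_exp_generic]) auto
  then have "real m ^ m / fact m \<le> exp (real m)"
    by (simp add: exp_def field_simps)
  then show ?thesis by (simp add: field_simps)
qed

lemma binomial_le_exp_power:
  assumes "m > 0"
  shows "real (n choose m) \<le> (exp 1 * real n / real m) ^ m"
proof -
  have "real (n choose m) * fact m \<le> real n ^ m"
    using binomial_fact_pow[of n m] by (metis of_nat_fact of_nat_le_iff of_nat_mult of_nat_power)
  then have "real (n choose m) * (fact m * exp (real m)) \<le> real n ^ m * exp (real m)"
    by (metis exp_ge_zero mult.assoc mult_right_mono)
  moreover have "real (n choose m) * real m ^ m \<le> real (n choose m) * (fact m * exp (real m))"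
    by (intro mult_left_mono power_self_le_fact_exp) simp
  ultimately have "real (n choose m) * real m ^ m \<le> real n ^ m * exp (real m)" by linarith
  moreover have "exp (real m) = exp 1 ^ m" by (simp add: exp_of_nat_mult[symmetric])
  ultimately show ?thesis
    using assms by (simp add: power_divide power_mult_distrib field_simps)
qed

text \<open>
  Each summand is at most \<open>(exp 1 * n / m * a ^ n) ^ (2 * m)\<close>, and \<open>m \<ge> k\<close> allows \<open>k\<close> in place of the \<open>m\<close>
  in the denominator; this is where the factor \<open>n / k\<close> of the rate condition comes from. The sum is
  then compared with the one starting at \<open>m = 1\<close>, whose bound vanishes together with \<open>y\<close>.
\<close>

lemma sum_far_le_geometric:
  fixes a :: real
  assumes "a > 0" "k > 0" and y: "y = (exp 1 * (real n / real k * a ^ n))\<^sup>2" and "y < 1"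
  shows "(\<Sum>m=k..N. real (n choose m) ^ 2 * a ^ (2 * m * n)) \<le> y / (1 - y)"
proof -
  have y0: "y \<ge> 0" by (simp add: y)
  have "(\<Sum>m=k..N. real (n choose m) ^ 2 * a ^ (2 * m * n)) \<le> (\<Sum>m=k..N. y ^ m)"
  proof (rule sum_mono)
    fix m assume m: "m \<in> {k..N}"
    have "real (n choose m) \<le> (exp 1 * real n / real m) ^ m"
      using m \<open>k > 0\<close> by (intro binomial_le_exp_power) auto
    also have "\<dots> \<le> (exp 1 * real n / real k) ^ m"
      using m \<open>k > 0\<close> by (intro power_mono divide_left_mono) auto
    finally have "real (n choose m) * a ^ (m * n) \<le> (exp 1 * real n / real k) ^ m * (a ^ n) ^ m"
      using \<open>a > 0\<close> by (simp add: power_mult[symmetric] mult.commute[of n m] mult_right_mono)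
    then have "real (n choose m) * a ^ (m * n) \<le> (exp 1 * (real n / real k * a ^ n)) ^ m"
      by (simp add: power_mult_distrib power_divide)
    then have "(real (n choose m) * a ^ (m * n))\<^sup>2 \<le> ((exp 1 * (real n / real k * a ^ n)) ^ m)\<^sup>2"
      using \<open>a > 0\<close> by (intro power_mono) auto
    then show "real (n choose m) ^ 2 * a ^ (2 * m * n) \<le> y ^ m"
      unfolding y by (simp add: power_mult_distrib power_mult[symmetric] mult_ac)
  qed
  also have "\<dots> \<le> (\<Sum>m=1..N. y ^ m)"
    using \<open>k > 0\<close> y0 by (intro sum_mono2) auto
  also have "\<dots> \<le> y / (1 - y)"
    using \<open>y < 1\<close> y0 by (cases "N = 0") (auto simp: sum_gp intro!: divide_right_mono)
  finally show ?thesis .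
qed

theorem theorem3p3:
  fixes p q :: "nat \<Rightarrow> real" and \<theta>\<^sub>0 :: "nat \<Rightarrow> (nat \<Rightarrow> nat) set" and k :: "nat \<Rightarrow> nat"
  assumes p: "\<And>n. n \<ge> 1 \<Longrightarrow> p n \<in> {0<..<1}"
    and q: "\<And>n. n \<ge> 1 \<Longrightarrow> q n \<in> {0<..<1}"
    and \<theta>0: "\<And>n. n \<ge> 1 \<Longrightarrow> \<theta>\<^sub>0 n \<in> Theta n"
    and k_pos: "\<And>n. n \<ge> 1 \<Longrightarrow> k n > 0"
    and k_bigo: "(\<lambda>n. real (k n)) \<in> O(\<lambda>n. real n)"
    and rate: "(\<lambda>n. real n / real (k n) *
        (1 - p n - q n + 2 * p n * q n + 2 * sqrt (p n * (1 - p n) * q n * (1 - q n)))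
          powr (real n / 2)) \<longlonglongrightarrow> 0"
  shows "\<forall>\<epsilon>>0. (\<lambda>n. measure_pmf.prob (graph_law n (p n) (q n) (\<theta>\<^sub>0 n))
      {x. \<bar>posterior n (p n) (q n) {\<theta> \<in> Theta n. kdist n \<theta> (\<theta>\<^sub>0 n) \<ge> k n} x\<bar> > \<epsilon>}) \<longlonglongrightarrow> 0"
proof (intro allI impI)
  fix \<epsilon> :: real assume "\<epsilon> > 0"
  define a where "a n = bernoulli_affinity (p n) (q n)" for n
  define y where "y n = (exp 1 * (real n / real (k n) * a n ^ n))\<^sup>2" for n
  have pos: "a n > 0" if "n \<ge> 1" for n
    unfolding a_def using bernoulli_affinity_pos p q that by blast
  have "a n ^ n = (1 - p n - q n + 2 * p n * q n + 2 * sqrt (p n * (1 - p n) * q n * (1 - q n)))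
          powr (real n / 2)" if "n \<ge> 1" for n
  proof -
    have "a n ^ n = (a n powr 2) powr (real n / 2)"
      using pos[OF that] by (simp only: powr_powr) (simp add: powr_realpow)
    also have "a n powr 2 = (a n)\<^sup>2" using pos[OF that] by simp
    finally show ?thesis
      unfolding a_def bernoulli_affinity_power2[OF p[OF that] q[OF that]] .
  qed
  then have "\<forall>\<^sub>F n in sequentially. real n / real (k n) *
        (1 - p n - q n + 2 * p n * q n + 2 * sqrt (p n * (1 - p n) * q n * (1 - q n)))
          powr (real n / 2) = real n / real (k n) * a n ^ n"
    by (auto simp: eventually_sequentially intro!: exI[of _ 1])
  from Lim_transform_eventually[OF rate this]
  have "(\<lambda>n. real n / real (k n) * a n ^ n) \<longlonglongrightarrow> 0" .
  then have "y \<longlonglongrightarrow> (exp 1 * 0)\<^sup>2"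
    unfolding y_def by (intro tendsto_intros)
  then have y: "y \<longlonglongrightarrow> 0" by simp
  then have "(\<lambda>n. y n / (1 - y n) / \<epsilon>) \<longlonglongrightarrow> 0 / (1 - 0) / \<epsilon>"
    using \<open>\<epsilon> > 0\<close> by (intro tendsto_intros) auto
  then have lim: "(\<lambda>n. y n / (1 - y n) / \<epsilon>) \<longlonglongrightarrow> 0" by simp
  have bound: "\<forall>\<^sub>F n in sequentially. measure_pmf.prob (graph_law n (p n) (q n) (\<theta>\<^sub>0 n))
      {x. \<bar>posterior n (p n) (q n) {\<theta> \<in> Theta n. kdist n \<theta> (\<theta>\<^sub>0 n) \<ge> k n} x\<bar> > \<epsilon>} \<le> y n / (1 - y n) / \<epsilon>"
    using eventually_ge_at_top[of 1] order_tendstoD(2)[OF y zero_less_one]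
  proof eventually_elim
    case (elim n)
    have "(\<Sum>m=k n..n div 2. real (n choose m) ^ 2 * a n ^ (2 * m * n)) \<le> y n / (1 - y n)"
      using pos k_pos elim y_def by (intro sum_far_le_geometric) auto
    with prob_posterior_far_le[OF p q \<theta>0 \<open>\<epsilon> > 0\<close>, OF elim(1) elim(1) elim(1), of "k n"] show ?case
      unfolding a_def using \<open>\<epsilon> > 0\<close> by (meson divide_right_mono less_imp_le order_trans)
  qed
  show "(\<lambda>n. measure_pmf.prob (graph_law n (p n) (q n) (\<theta>\<^sub>0 n))
      {x. \<bar>posterior n (p n) (q n) {\<theta> \<in> Theta n. kdist n \<theta> (\<theta>\<^sub>0 n) \<ge> k n} x\<bar> > \<epsilon>}) \<longlonglongrightarrow> 0"
    by (rule tendsto_sandwich[OF _ bound tendsto_const lim]) simp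
qed

end
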